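(* For all integers $n\ge 0$ and $r\ge 0$, \[ B_{n,r}^{L}=\sum_{k=0}^{n}(-1)^{n-k}S_{1}(n,k)\,B_{k,2r} \qquad\text{and}\qquad B_{n,2r}=\sum_{k=0}^{n}(-1)^{n-k}S_{2}(n,k)\,B_{k,r}^{L}. \]
   Context: For a nonnegative integer $r$ and integers $0\le k\le n$, the $r$-Lah number $L_r(n,k)$ is the number of partitions of a set with $n+r$ elements into $k+r$ non-empty linearly ordered subsets such that $r$ distinguished elements lie in distinct subsets; its exponential generating function is $\sum_{n\ge k}L_r(n,k)\frac{t^n}{n!}=\frac{1}{k!}\left(\frac{1}{1-t}-1\right)^k\left(\frac{1}{1-t}\right)^{2r}$. The $r$-extended Lah-Bell number is $B^L_{n,r}=\sum_{k=0}^n L_r(n,k)$. The $r$-extended Bell numbers $B_{n,r}$ are defined by $e^{e^t-1+rt}=\sum_{n\ge0}B_{n,r}\frac{t^n}{n!}$. The (signed) Stirling numbers of the first kind $S_1(n,k)$ are defined by $(x)_n=\sum_{k=0}^nS_1(n,k)x^k$, where $(x)_n=x(x-1)\cdots(x-n+1)$, and the Stirling numbers of the second kind $S_2(n,k)$ by $x^n=\sum_{k=0}^nS_2(n,k)(x)_k$. *)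

theory Defs
  imports
    "HOL-Library.Disjoint_Sets"
    "HOL-Combinatorics.Stirling"
    "HOL-Computational_Algebra.Computational_Algebra"
begin

text \<open>
  The ground set is \<open>{..<n + r}\<close> and the distinguished elements are \<open>{..<r}\<close>. A linearly
  ordered set is represented by the list of its elements in increasing order; injectivity of
  \<^const>\<open>set\<close> says that each block of the partition carries exactly one ordering.
\<close>

definition r_Lah_partitions :: "nat \<Rightarrow> nat \<Rightarrow> nat \<Rightarrow> nat list set set" where
  "r_Lah_partitions r n k =
     {P. partition_on {..<n + r} (set ` P) \<and> inj_on set P \<and> (\<forall>xs\<in>P. distinct xs) \<and>
         card P = k + r \<and>
         (\<forall>xs\<in>P. \<forall>i\<in>set xs. \<forall>j\<in>set xs. i < r \<and> j < r \<longrightarrow> i = j)}"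

definition r_Lah :: "nat \<Rightarrow> nat \<Rightarrow> nat \<Rightarrow> nat" where
  "r_Lah r n k = card (r_Lah_partitions r n k)"

definition ext_Lah_Bell :: "nat \<Rightarrow> nat \<Rightarrow> nat" where
  "ext_Lah_Bell n r = (\<Sum>k\<le>n. r_Lah r n k)"

definition ext_Bell_egf :: "nat \<Rightarrow> real fps" where
  "ext_Bell_egf r = fps_exp 1 oo (fps_exp 1 - 1 + of_nat r * fps_X)"

definition ext_Bell :: "nat \<Rightarrow> nat \<Rightarrow> real" where
  "ext_Bell n r = fact n * fps_nth (ext_Bell_egf r) n"

definition falling_poly :: "nat \<Rightarrow> int poly" where
  "falling_poly n = (\<Prod>i<n. [:- int i, 1:])"

text \<open>
  The signed Stirling numbers of the first kind. (The library's \<^const>\<open>stirling\<close> is the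
  unsigned variant.)
\<close>

definition S1 :: "nat \<Rightarrow> nat \<Rightarrow> int" where
  "S1 n k = coeff (falling_poly n) k"

text \<open>
  The Stirling numbers of the second kind are the library's \<^const>\<open>Stirling\<close>, which is defined by
  its recurrence. The following two facts show that they are exactly the coefficients of
  \<open>x ^ n\<close> in the basis of falling factorials.
\<close>

lemma degree_falling_poly [simp]: "degree (falling_poly n) = n"
  unfolding falling_poly_def by (subst degree_prod_eq_sum_degree) auto

lemma lead_coeff_falling_poly: "coeff (falling_poly n) n = 1"
proof -
  have "lead_coeff (falling_poly n) = 1"
    unfolding falling_poly_def by (subst lead_coeff_prod) simp
  then show ?thesis by simp
qed

lemma monom_eq_sum_Stirling:
  "monom 1 n = (\<Sum>k\<le>n. smult (int (Stirling n k)) (falling_poly k))"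
proof (induction n)
  case 0
  show ?case by (simp add: falling_poly_def)
next
  case (Suc n)
  have step: "[:0, 1:] * falling_poly k = falling_poly (Suc k) + smult (int k) (falling_poly k)" for k
    by (simp add: falling_poly_def algebra_simps)
  let ?f = "\<lambda>k. smult (int (k * Stirling n k)) (falling_poly k)"
  have "monom 1 (Suc n) = [:0, 1:] * (monom 1 n :: int poly)"
    by (simp add: monom_Suc)
  also have "\<dots> = (\<Sum>k\<le>n. smult (int (Stirling n k)) ([:0, 1:] * falling_poly k))"
    by (subst Suc.IH) (simp only: sum_distrib_left mult_smult_right)
  also have "\<dots> = (\<Sum>k\<le>n. smult (int (Stirling n k)) (falling_poly (Suc k))) + (\<Sum>k\<le>n. ?f k)"
    by (simp only: step) (simp add: smult_add_right sum.distrib mult.commute)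
  also have "(\<Sum>k\<le>n. ?f k) = (\<Sum>k\<le>Suc n. ?f k)"
    by simp
  also have "\<dots> = (\<Sum>k\<le>n. ?f (Suc k))"
    by (subst sum.atMost_Suc_shift) simp
  also have "(\<Sum>k\<le>n. smult (int (Stirling n k)) (falling_poly (Suc k))) + (\<Sum>k\<le>n. ?f (Suc k))
      = (\<Sum>k\<le>n. smult (int (Stirling (Suc n) (Suc k))) (falling_poly (Suc k)))"
    by (subst sum.distrib [symmetric], rule sum.cong) (simp_all add: smult_add_left [symmetric] ac_simps)
  also have "\<dots> = (\<Sum>k\<le>Suc n. smult (int (Stirling (Suc n) k)) (falling_poly k))"
    by (subst sum.atMost_Suc_shift) simp
  finally show ?case .
qed

lemma falling_poly_independent:
  assumes "(\<Sum>k\<le>n. smult (c k) (falling_poly k)) = 0" and "k \<le> n"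
  shows "c k = 0"
  using assms
proof (induction n)
  case 0
  then show ?case by (simp add: falling_poly_def)
next
  case (Suc n)
  have "0 = coeff (\<Sum>k\<le>Suc n. smult (c k) (falling_poly k)) (Suc n)"
    by (simp only: Suc.prems(1) coeff_0)
  also have "\<dots> = (\<Sum>k\<le>n. c k * coeff (falling_poly k) (Suc n)) + c (Suc n)"
    by (simp add: coeff_sum lead_coeff_falling_poly)
  also have "(\<Sum>k\<le>n. c k * coeff (falling_poly k) (Suc n)) = 0"
    by (intro sum.neutral ballI) (simp add: coeff_eq_0)
  finally have "c (Suc n) = 0" by simp
  with Suc show ?case by (cases "k = Suc n") auto
qed

lemma Stirling_unique:
  assumes "monom 1 n = (\<Sum>k\<le>n. smult (s k) (falling_poly k))" and "k \<le> n"
  shows "s k = int (Stirling n k)"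
proof -
  have "(\<Sum>k\<le>n. smult (s k - int (Stirling n k)) (falling_poly k)) = 0"
    using assms(1) monom_eq_sum_Stirling [of n] by (simp add: smult_diff_left sum_subtractf)
  from falling_poly_independent [OF this assms(2)] show ?thesis by simp
qed

end

theory Submission
  imports Defs
begin

text \<open>
  Let $\Lambda_s$ be the linear functional on polynomials that sends $x^n$ to $B_{n,s}$. The
  generating function gives $B_{n+1,s} = B_{n,s+1} + s B_{n,s}$, that is,
  $\Lambda_s((x - s) p) = \Lambda_{s+1}(p)$, so $\Lambda_s$ sends every product
  $(x - s)(x - s - 1) \cdots (x - s - k + 1)$ to $1$. Removing the largest element from a partition
  into ordered blocks gives $L_r(n+1,k) = L_r(n,k-1) + (n + k + 2r) L_r(n,k)$, hence
  $x(x+1) \cdots (x+n-1) = \sum_k L_r(n,k) (x - 2r) \cdots (x - 2r - k + 1)$, and $\Lambda_{2r}$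
  maps the rising factorial to $B^L_{n,r}$. Both identities are $\Lambda_{2r}$ applied to the change
  of basis between monomials and rising factorials.
\<close>

section \<open>Partitions into ordered blocks with marked elements\<close>

text \<open>The ground set \<open>A\<close> and the marked set \<open>D\<close> are separated so
  that an induction can add elements to \<open>A\<close> while \<open>D\<close> stays fixed. The
  parameter \<open>m\<close> counts all blocks, which is \<open>k + r\<close> for
  \<open>r_Lah\<close>.\<close>

definition ordered_partitions :: "'a set \<Rightarrow> 'a set \<Rightarrow> nat \<Rightarrow> 'a list set set" where
  "ordered_partitions D A m =
     {P. partition_on A (set ` P) \<and> inj_on set P \<and> (\<forall>xs\<in>P. distinct xs) \<and> card P = m \<and>
         (\<forall>xs\<in>P. \<forall>i\<in>set xs. \<forall>j\<in>set xs. i \<in> D \<and> j \<in> D \<longrightarrow> i = j)}"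

lemma r_Lah_eq: "r_Lah r n k = card (ordered_partitions {..<r} {..<n + r} (k + r))"
  by (simp add: r_Lah_def r_Lah_partitions_def ordered_partitions_def)

lemma mem_ordered_partitions_iff:
  "P \<in> ordered_partitions D A m \<longleftrightarrow>
     [] \<notin> P \<and> \<Union>(set ` P) = A \<and> (\<forall>xs\<in>P. \<forall>ys\<in>P. xs \<noteq> ys \<longrightarrow> set xs \<inter> set ys = {}) \<and>
     (\<forall>xs\<in>P. distinct xs) \<and> card P = m \<and>
     (\<forall>xs\<in>P. \<forall>i\<in>set xs. \<forall>j\<in>set xs. i \<in> D \<and> j \<in> D \<longrightarrow> i = j)"
proof -
  have "partition_on A (set ` P) \<and> inj_on set P \<longleftrightarrow>
      [] \<notin> P \<and> \<Union>(set ` P) = A \<and> (\<forall>xs\<in>P. \<forall>ys\<in>P. xs \<noteq> ys \<longrightarrow> set xs \<inter> set ys = {})"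
    (is "?L \<longleftrightarrow> ?R")
  proof
    assume L: ?L
    have "set xs \<inter> set ys = {}" if "xs \<in> P" "ys \<in> P" "xs \<noteq> ys" for xs ys
    proof -
      have "set xs \<noteq> set ys" using L that by (meson inj_onD)
      then show ?thesis
        using L that by (meson disjointD image_eqI partition_onD2)
    qed
    moreover have "[] \<notin> P" using L partition_onD3 by fastforce
    ultimately show ?R using L partition_onD1 by blast
  next
    assume R: ?R
    have "set xs \<noteq> set ys" if "xs \<in> P" "ys \<in> P" "xs \<noteq> ys" for xs ys
    proof -
      have "set xs \<inter> set ys = {}" "xs \<noteq> []" using R that by blast+
      then show ?thesis by auto
    qed
    then have "inj_on set P" by (meson inj_onI)
    moreover have "disjoint (set ` P)"
      unfolding disjoint_def using R by (metis (no_types, lifting) imageE)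
    moreover have "{} \<notin> set ` P" using R by auto
    ultimately show ?L using R unfolding partition_on_def by blast
  qed
  then show ?thesis
    unfolding ordered_partitions_def by blast
qed

lemma ordered_partitions_blockD:
  assumes "P \<in> ordered_partitions D A m" "xs \<in> P"
  shows "xs \<noteq> []" "distinct xs" "set xs \<subseteq> A"
    "\<forall>i\<in>set xs. \<forall>j\<in>set xs. i \<in> D \<and> j \<in> D \<longrightarrow> i = j"
proof -
  have P: "[] \<notin> P" "\<Union>(set ` P) = A" "\<forall>xs\<in>P. distinct xs"
    "\<forall>xs\<in>P. \<forall>i\<in>set xs. \<forall>j\<in>set xs. i \<in> D \<and> j \<in> D \<longrightarrow> i = j"
    using assms(1) by (simp_all add: mem_ordered_partitions_iff)
  show "xs \<noteq> []" using P(1) assms(2) by auto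
  show "distinct xs" using P(3) assms(2) by auto
  show "set xs \<subseteq> A" using P(2) assms(2) by blast
  show "\<forall>i\<in>set xs. \<forall>j\<in>set xs. i \<in> D \<and> j \<in> D \<longrightarrow> i = j"
    using P(4) assms(2) by (rule bspec)
qed

lemma ordered_partitions_disjointD:
  assumes "P \<in> ordered_partitions D A m" "xs \<in> P" "ys \<in> P" "xs \<noteq> ys"
  shows "set xs \<inter> set ys = {}"
  using assms by (simp add: mem_ordered_partitions_iff)

lemma finite_ordered_partitions:
  assumes "finite A"
  shows "finite (ordered_partitions D A m)"
proof (rule finite_subset)
  show "ordered_partitions D A m \<subseteq> Pow {xs. set xs \<subseteq> A \<and> distinct xs}"
    by (auto simp: mem_ordered_partitions_iff)
  show "finite (Pow {xs. set xs \<subseteq> A \<and> distinct xs})"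
    using assms by (simp add: finite_subset_distinct)
qed

lemma finite_ordered_partition:
  assumes "finite A" "P \<in> ordered_partitions D A m"
  shows "finite P"
  by (rule finite_subset[OF _ finite_subset_distinct[OF assms(1)]])
     (use assms(2) in \<open>auto simp: mem_ordered_partitions_iff\<close>)

text \<open>A block holds at most one marked element, so if all elements are marked only the
  partition into singletons remains. This is the base case \<open>n = 0\<close> of the r-Lah
  numbers.\<close>

lemma ordered_partitions_all_marked:
  assumes "finite D"
  shows "ordered_partitions D D m = (if m = card D then {(\<lambda>i. [i]) ` D} else {})"
proof -
  have sing: "P = (\<lambda>i. [i]) ` D" if P: "P \<in> ordered_partitions D D m" for P
  proof -
    have *: "\<exists>i\<in>D. xs = [i]" if "xs \<in> P" for xs
    proof -
      have xs: "xs \<noteq> []" "distinct xs" "set xs \<subseteq> D" "\<forall>i\<in>set xs. \<forall>j\<in>set xs. i = j"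
        using ordered_partitions_blockD[OF P that] by auto
      then obtain x ys where x: "xs = x # ys" by (meson neq_Nil_conv)
      have "ys = []"
      proof (rule ccontr)
        assume "ys \<noteq> []"
        then have "hd ys \<in> set ys" by simp
        moreover from this have "hd ys = x" using xs(4) unfolding x by (meson list.set_intros)
        ultimately show False using xs(2) x by simp
      qed
      with x xs(3) show ?thesis by simp
    qed
    have "i \<in> D \<Longrightarrow> [i] \<in> P" for i
    proof -
      assume "i \<in> D"
      then obtain xs where "xs \<in> P" "i \<in> set xs"
        using P by (auto simp: mem_ordered_partitions_iff)
      with * show "[i] \<in> P" by fastforce
    qed
    with * show ?thesis by blast
  qed
  have card: "card ((\<lambda>i. [i]) ` D) = card D"
    by (intro card_image) (auto simp: inj_on_def)
  have mem: "(\<lambda>i. [i]) ` D \<in> ordered_partitions D D (card D)"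
    using card by (auto simp: mem_ordered_partitions_iff)
  have blocks: "m = card D" if "P \<in> ordered_partitions D D m" for P
    using sing[OF that] that card by (simp add: mem_ordered_partitions_iff)
  show ?thesis
  proof (cases "m = card D")
    case True
    have "P \<in> ordered_partitions D D m \<longleftrightarrow> P = (\<lambda>i. [i]) ` D" for P
    proof
      show "P \<in> ordered_partitions D D m" if "P = (\<lambda>i. [i]) ` D"
        unfolding that True by (rule mem)
    qed (rule sing)
    then have "ordered_partitions D D m = {(\<lambda>i. [i]) ` D}" by (intro set_eqI) (simp only: singleton_iff)
    with True show ?thesis by simp
  next
    case False
    then have "ordered_partitions D D m = {}" using blocks by (meson equals0I)
    with False show ?thesis by simp
  qed
qed

section \<open>Adding one element to an ordered partition\<close>

lemma card_splits: "card {(ys, zs). ys @ zs = xs} = Suc (length xs)"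
proof -
  have "{(ys, zs). ys @ zs = xs} = (\<lambda>i. (take i xs, drop i xs)) ` {..length xs}"
  proof (intro equalityI subsetI)
    fix p assume "p \<in> {(ys, zs). ys @ zs = xs}"
    then have "p = (take (length (fst p)) xs, drop (length (fst p)) xs)" "length (fst p) \<le> length xs"
      by auto
    then show "p \<in> (\<lambda>i. (take i xs, drop i xs)) ` {..length xs}" by blast
  qed auto
  moreover have "inj_on (\<lambda>i. (take i xs, drop i xs)) {..length xs}"
    by (rule inj_onI) (metis atMost_iff length_take min.absorb2 prod.inject)
  ultimately show ?thesis
    by (simp add: card_image)
qed

lemma finite_splits: "finite {(ys, zs). ys @ zs = xs}"
  using card_splits[of xs] by (intro card_ge_0_finite) simp

text \<open>A block of length l has l + 1 gaps; the lengths add up to \<open>card A\<close>, and the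
  extra ones to the number of blocks.\<close>

lemma card_insertion_places:
  assumes "finite A" "P \<in> ordered_partitions D A m"
  shows "card {(ys, zs). ys @ zs \<in> P} = card A + m" "finite {(ys, zs). ys @ zs \<in> P}"
proof -
  have fin: "finite P"
    using finite_ordered_partition[OF assms] .
  have eq: "{(ys, zs). ys @ zs \<in> P} = (\<Union>xs\<in>P. {(ys, zs). ys @ zs = xs})"
    by auto
  show "finite {(ys, zs). ys @ zs \<in> P}"
    unfolding eq using fin finite_splits by blast
  have "card {(ys, zs). ys @ zs \<in> P} = (\<Sum>xs\<in>P. Suc (length xs))"
    unfolding eq by (subst card_UN_disjoint) (auto simp: fin finite_splits card_splits)
  also have "\<dots> = (\<Sum>xs\<in>P. card (set xs)) + card P"
    using assms(2) by (simp add: sum_Suc mem_ordered_partitions_iff distinct_card)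
  also have "(\<Sum>xs\<in>P. card (set xs)) = card (\<Union>xs\<in>P. set xs)"
    using assms(2) fin
    by (subst card_UN_disjoint) (auto simp: mem_ordered_partitions_iff)
  also have "\<dots> + card P = card A + m"
    using assms(2) by (simp add: mem_ordered_partitions_iff)
  finally show "card {(ys, zs). ys @ zs \<in> P} = card A + m" .
qed

text \<open>First case of the recurrence: the new element \<open>a\<close> is a block by itself, and
  deleting that block is the inverse map.\<close>

lemma insert_singleton_block:
  assumes "finite A" "a \<notin> A"
  shows "bij_betw (insert [a]) (ordered_partitions D A m)
           {P \<in> ordered_partitions D (insert a A) (Suc m). [a] \<in> P}"
proof (rule bij_betw_byWitness[where f' = "\<lambda>P. P - {[a]}"])
  have notin: "[a] \<notin> P" if "P \<in> ordered_partitions D A m" for P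
    using that assms by (auto simp: mem_ordered_partitions_iff)
  then show "\<forall>P\<in>ordered_partitions D A m. insert [a] P - {[a]} = P" by blast
  show "\<forall>P\<in>{P \<in> ordered_partitions D (insert a A) (Suc m). [a] \<in> P}. insert [a] (P - {[a]}) = P"
    by blast
  show "insert [a] ` ordered_partitions D A m \<subseteq>
      {P \<in> ordered_partitions D (insert a A) (Suc m). [a] \<in> P}"
  proof
    fix Q assume "Q \<in> insert [a] ` ordered_partitions D A m"
    then obtain P where P: "P \<in> ordered_partitions D A m" and Q: "Q = insert [a] P" by blast
    have "card Q = Suc m"
      using finite_ordered_partition[OF assms(1) P] notin[OF P] P Q
      by (simp add: mem_ordered_partitions_iff)
    moreover have "\<forall>xs\<in>P. a \<notin> set xs"
      using P assms(2) by (auto simp: mem_ordered_partitions_iff)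
    ultimately show "Q \<in> {P \<in> ordered_partitions D (insert a A) (Suc m). [a] \<in> P}"
      using P Q unfolding mem_ordered_partitions_iff by auto
  qed
  show "(\<lambda>P. P - {[a]}) ` {P \<in> ordered_partitions D (insert a A) (Suc m). [a] \<in> P}
      \<subseteq> ordered_partitions D A m"
  proof
    fix Q assume "Q \<in> (\<lambda>P. P - {[a]}) ` {P \<in> ordered_partitions D (insert a A) (Suc m). [a] \<in> P}"
    then obtain P where P: "P \<in> ordered_partitions D (insert a A) (Suc m)" "[a] \<in> P"
      and Q: "Q = P - {[a]}" by blast
    have a: "a \<notin> set xs" if "xs \<in> Q" for xs
    proof -
      have "set xs \<inter> set [a] = {}"
        using ordered_partitions_disjointD[OF P(1) _ P(2)] that Q by blast
      then show ?thesis by simp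
    qed
    have "\<Union>(set ` P) = insert a A"
      using P by (simp add: mem_ordered_partitions_iff)
    moreover have "P = insert [a] Q" using P Q by blast
    ultimately have "insert a (\<Union>(set ` Q)) = insert a A" by simp
    moreover have "a \<notin> \<Union>(set ` Q)" using a by blast
    ultimately have "\<Union>(set ` Q) = A"
      using assms(2) by (metis insert_ident)
    moreover have "card Q = m"
      using P Q by (simp add: mem_ordered_partitions_iff)
    moreover have "\<forall>xs\<in>Q. \<forall>i\<in>set xs. \<forall>j\<in>set xs. i \<in> D \<and> j \<in> D \<longrightarrow> i = j"
      using ordered_partitions_blockD(4)[OF P(1)] Q by blast
    ultimately show "Q \<in> ordered_partitions D A m"
      using P Q unfolding mem_ordered_partitions_iff by simp
  qed
qed

text \<open>Serves both directions of the next bijection: \<open>ys\<close> will be the block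
  \<open>xs\<close> with the new element inserted, or with it deleted.\<close>

lemma replace_block:
  assumes "finite A" and P: "P \<in> ordered_partitions D A m" and xs: "xs \<in> P"
    and ys: "ys \<noteq> []" "distinct ys" "set ys \<inter> (A - set xs) = {}"
      "\<forall>i\<in>set ys. \<forall>j\<in>set ys. i \<in> D \<and> j \<in> D \<longrightarrow> i = j"
  shows "insert ys (P - {xs}) \<in> ordered_partitions D (A - set xs \<union> set ys) m"
proof -
  let ?R = "P - {xs}"
  have fin: "finite P" using finite_ordered_partition[OF assms(1) P] .
  have UnP: "\<Union>(set ` P) = A" and cardP: "card P = m" and neP: "[] \<notin> P"
    using P by (simp_all add: mem_ordered_partitions_iff)
  have disjP: "set us \<inter> set vs = {}" if "us \<in> P" "vs \<in> P" "us \<noteq> vs" for us vs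
    using ordered_partitions_disjointD[OF P] that by blast
  have R: "set us \<subseteq> A - set xs" if "us \<in> ?R" for us
    using that UnP disjP[of us xs] xs by blast
  have new: "set us \<inter> set ys = {}" if "us \<in> ?R" for us
    using R[OF that] ys(3) by blast
  then have "ys \<notin> ?R" using ys(1) by (metis inf.idem set_empty)
  then have "card (insert ys ?R) = Suc (card ?R)"
    using fin by (intro card_insert_disjoint) auto
  also have "\<dots> = card P" using fin xs by (rule card_Suc_Diff1)
  finally have "card (insert ys ?R) = m" using cardP by simp
  moreover have "\<Union>(set ` ?R) = A - set xs"
    using R UnP by blast
  then have "\<Union>(set ` insert ys ?R) = A - set xs \<union> set ys" by auto
  moreover have "set us \<inter> set vs = {}"
    if "us \<in> insert ys ?R" "vs \<in> insert ys ?R" "us \<noteq> vs" for us vs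
  proof (cases "us = ys \<or> vs = ys")
    case True
    then show ?thesis using that new[of us] new[of vs] by (auto simp: Int_commute)
  next
    case False
    then show ?thesis using that disjP[of us vs] by simp
  qed
  moreover have "\<forall>us\<in>insert ys ?R. distinct us"
    using P ys(2) by (simp add: mem_ordered_partitions_iff)
  moreover have "\<forall>us\<in>P. \<forall>i\<in>set us. \<forall>j\<in>set us. i \<in> D \<and> j \<in> D \<longrightarrow> i = j"
    using P by (simp add: mem_ordered_partitions_iff)
  then have "\<forall>us\<in>insert ys ?R. \<forall>i\<in>set us. \<forall>j\<in>set us. i \<in> D \<and> j \<in> D \<longrightarrow> i = j"
    using ys(4) by (metis DiffD1 insertE)
  moreover have "[] \<notin> insert ys ?R" using neP ys(1) by simp
  ultimately show ?thesis
    unfolding mem_ordered_partitions_iff by (intro conjI ballI impI) blast+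
qed

text \<open>
  A split of a block into \<open>ys @ zs\<close> records the block together with a position in it.
\<close>

lemma insert_into_block:
  assumes "finite A" "a \<notin> A" "a \<notin> D"
  shows "bij_betw (\<lambda>(P, ys, zs). insert (ys @ a # zs) (P - {ys @ zs}))
           (SIGMA P:ordered_partitions D A m. {(ys, zs). ys @ zs \<in> P})
           {P \<in> ordered_partitions D (insert a A) m. [a] \<notin> P}"
  (is "bij_betw ?f ?S ?T")
proof -
  have notin: "a \<notin> set xs" if "P \<in> ordered_partitions D A m" "xs \<in> P" for P xs
    using that assms(2) by (auto simp: mem_ordered_partitions_iff)
  have inj: "inj_on ?f ?S"
  proof (rule inj_onI, clarify)
    fix P ys zs Q us vs
    assume P: "P \<in> ordered_partitions D A m" "ys @ zs \<in> P"
      and Q: "Q \<in> ordered_partitions D A m" "us @ vs \<in> Q"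
      and eq: "insert (ys @ a # zs) (P - {ys @ zs}) = insert (us @ a # vs) (Q - {us @ vs})"
    have nP: "a \<notin> set xs" if "xs \<in> P" for xs using notin P that by blast
    have nQ: "a \<notin> set xs" if "xs \<in> Q" for xs using notin Q that by blast
    \<comment> \<open>The element \<open>a\<close> occurs in no block of \<open>Q\<close>, so the
      block containing it must be the new one.\<close>
    have "ys @ a # zs \<in> insert (us @ a # vs) (Q - {us @ vs})"
      using eq by blast
    then have "ys @ a # zs = us @ a # vs"
      using nQ by fastforce
    moreover have "a \<notin> set ys" "a \<notin> set us" "a \<notin> set zs" "a \<notin> set vs"
      using nP[OF P(2)] nQ[OF Q(2)] by auto
    ultimately have *: "ys = us" "zs = vs"
      by (auto simp: append_Cons_eq_iff)
    \<comment> \<open>The new block was in neither partition, so it can be cancelled from both sides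
      of \<open>eq\<close>.\<close>
    have "ys @ a # zs \<notin> P" "us @ a # vs \<notin> Q"
      using nP nQ by fastforce+
    with eq * P(2) Q(2) show "P = Q \<and> (ys, zs) = (us, vs)"
      by (simp add: insert_ident) blast
  qed
  have sub: "?f ` ?S \<subseteq> ?T"
  proof (clarify, intro conjI)
    fix P ys zs
    assume P: "P \<in> ordered_partitions D A m" "ys @ zs \<in> P"
    let ?Q = "insert (ys @ a # zs) (P - {ys @ zs})"
    have nP: "a \<notin> set xs" if "xs \<in> P" for xs using notin P that by blast
    have block: "ys @ zs \<noteq> []" "distinct (ys @ zs)" "set (ys @ zs) \<subseteq> A"
      "\<forall>i\<in>set (ys @ zs). \<forall>j\<in>set (ys @ zs). i \<in> D \<and> j \<in> D \<longrightarrow> i = j"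
      using ordered_partitions_blockD[OF P] by simp_all
    have "[a] \<noteq> ys @ a # zs" using block(1) by (cases ys) auto
    then show "[a] \<notin> ?Q" using nP[of "[a]"] by auto
    have "A - set (ys @ zs) \<union> set (ys @ a # zs) = insert a A"
      using block(3) by auto
    moreover have "?Q \<in> ordered_partitions D (A - set (ys @ zs) \<union> set (ys @ a # zs)) m"
      using block nP[OF P(2)] assms by (intro replace_block P) auto
    ultimately show "?Q \<in> ordered_partitions D (insert a A) m" by simp
  qed
  have "?T \<subseteq> ?f ` ?S"
  proof clarify
    fix Q assume Q: "Q \<in> ordered_partitions D (insert a A) m" "[a] \<notin> Q"
    then have "a \<in> \<Union>(set ` Q)" by (simp add: mem_ordered_partitions_iff)
    then obtain xs where xs: "xs \<in> Q" "a \<in> set xs" by blast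
    then obtain ys zs where split: "xs = ys @ a # zs" by (meson split_list)
    let ?P = "insert (ys @ zs) (Q - {xs})"
    have block: "distinct xs" "set xs \<subseteq> insert a A"
      "\<forall>i\<in>set xs. \<forall>j\<in>set xs. i \<in> D \<and> j \<in> D \<longrightarrow> i = j"
      using ordered_partitions_blockD[OF Q(1) xs(1)] by simp_all
    \<comment> \<open>Otherwise \<open>xs\<close> would be the excluded block
      \<open>[a]\<close>.\<close>
    have ne: "ys @ zs \<noteq> []" using Q(2) xs(1) split by auto
    have "insert a A - set xs \<union> set (ys @ zs) = A"
      using block assms(2) split by auto
    moreover have "?P \<in> ordered_partitions D (insert a A - set xs \<union> set (ys @ zs)) m"
      using block ne assms(1) split by (intro replace_block Q xs) auto
    ultimately have "?P \<in> ordered_partitions D A m" by simp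
    \<comment> \<open>Hence removing the shortened block from \<open>?P\<close> leaves exactly
      \<open>Q - {xs}\<close>, and reinserting \<open>xs\<close> gives back
      \<open>Q\<close>.\<close>
    moreover have "ys @ zs \<notin> Q - {xs}"
    proof
      assume "ys @ zs \<in> Q - {xs}"
      then have "set (ys @ zs) \<inter> set xs = {}"
        using ordered_partitions_disjointD[OF Q(1) _ xs(1)] by blast
      with ne split show False by auto
    qed
    then have "Q = ?f (?P, ys, zs)"
      using xs(1) split by auto
    ultimately show "Q \<in> ?f ` ?S" by blast
  qed
  with inj sub show ?thesis unfolding bij_betw_def by blast
qed

text \<open>The number of insertion places is the same for every partition, so the sum over
  partitions collapses to a product.\<close>

lemma card_ordered_partitions_without_singleton:
  assumes "finite A" "a \<notin> A" "a \<notin> D"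
  shows "card {P \<in> ordered_partitions D (insert a A) m. [a] \<notin> P} =
           (card A + m) * card (ordered_partitions D A m)"
proof -
  have "card {P \<in> ordered_partitions D (insert a A) m. [a] \<notin> P} =
      card (SIGMA P:ordered_partitions D A m. {(ys, zs). ys @ zs \<in> P})"
    using bij_betw_same_card[OF insert_into_block[OF assms, of m]] by simp
  also have "\<dots> = (\<Sum>P\<in>ordered_partitions D A m. card {(ys, zs). ys @ zs \<in> P})"
    using assms(1) finite_ordered_partitions card_insertion_places(2) by (intro card_SigmaI) blast+
  also have "\<dots> = (card A + m) * card (ordered_partitions D A m)"
    using assms(1) by (simp add: card_insertion_places(1))
  finally show ?thesis .
qed

lemma card_ordered_partitions_insert_0:
  assumes "finite A" "a \<notin> A" "a \<notin> D"
  shows "card (ordered_partitions D (insert a A) 0) = card A * card (ordered_partitions D A 0)"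
proof -
  \<comment> \<open>Finiteness of \<open>P\<close> turns \<open>card P = 0\<close> into
    \<open>P = {}\<close>; an infinite set has cardinality 0 as well.\<close>
  have "[a] \<notin> P" if "P \<in> ordered_partitions D (insert a A) 0" for P
    using finite_ordered_partition[OF _ that] that assms(1)
    by (auto simp: mem_ordered_partitions_iff)
  then have "{P \<in> ordered_partitions D (insert a A) 0. [a] \<notin> P} = ordered_partitions D (insert a A) 0"
    by blast
  with card_ordered_partitions_without_singleton[OF assms, of 0] show ?thesis by simp
qed

lemma card_ordered_partitions_insert_Suc:
  assumes "finite A" "a \<notin> A" "a \<notin> D"
  shows "card (ordered_partitions D (insert a A) (Suc m)) =
           card (ordered_partitions D A m) + (card A + Suc m) * card (ordered_partitions D A (Suc m))"
proof -
  let ?O = "ordered_partitions D (insert a A) (Suc m)"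
  have "?O = {P \<in> ?O. [a] \<in> P} \<union> {P \<in> ?O. [a] \<notin> P}" by blast
  moreover have "card ({P \<in> ?O. [a] \<in> P} \<union> {P \<in> ?O. [a] \<notin> P}) =
      card {P \<in> ?O. [a] \<in> P} + card {P \<in> ?O. [a] \<notin> P}"
    using assms(1) by (intro card_Un_disjoint) (auto simp: finite_ordered_partitions)
  ultimately show ?thesis
    using bij_betw_same_card[OF insert_singleton_block[OF assms(1,2), of D m]]
      card_ordered_partitions_without_singleton[OF assms, of "Suc m"] by simp
qed

text \<open>The \<open>r\<close> marked elements need \<open>r\<close> different blocks. The
  recurrences prove this by induction on \<open>n\<close>, starting from the case where all elements
  are marked.\<close>

lemma card_ordered_partitions_few_blocks:
  "m < r \<Longrightarrow> card (ordered_partitions {..<r} {..<n + r} m) = 0"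
proof (induction n arbitrary: m)
  case 0
  then show ?case by (simp add: ordered_partitions_all_marked)
next
  case (Suc n)
  have "{..<Suc n + r} = insert (n + r) {..<n + r}" by auto
  with Suc show ?case
    by (cases m) (simp_all add: card_ordered_partitions_insert_0 card_ordered_partitions_insert_Suc)
qed

section \<open>Recurrence of the r-Lah numbers\<close>

lemma r_Lah_0: "r_Lah r 0 k = (if k = 0 then 1 else 0)"
  by (simp add: r_Lah_eq ordered_partitions_all_marked)

lemma r_Lah_Suc_0: "r_Lah r (Suc n) 0 = (n + 2 * r) * r_Lah r n 0"
proof (cases r)
  case 0
  then show ?thesis
    by (simp add: r_Lah_eq lessThan_Suc card_ordered_partitions_insert_0)
next
  case (Suc q)
  have "{..<Suc n + r} = insert (n + r) {..<n + r}" by auto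
  \<comment> \<open>With \<open>r = Suc q\<close>, making the new element a singleton leaves only
    \<open>q\<close> blocks for \<open>r\<close> marked elements, so the first summand
    vanishes.\<close>
  then have "r_Lah r (Suc n) 0 = card (ordered_partitions {..<r} {..<n + r} q) + (n + 2 * r) * r_Lah r n 0"
    using card_ordered_partitions_insert_Suc[of "{..<n + r}" "n + r" "{..<r}" q] Suc
    by (simp add: r_Lah_eq algebra_simps)
  with card_ordered_partitions_few_blocks[of q r n] Suc show ?thesis by simp
qed

text \<open>The factor is the number of insertion places: \<open>n + r\<close> elements in
  \<open>Suc k + r\<close> blocks. Elements and blocks contribute \<open>r\<close> each, which is
  the source of \<open>2 * r\<close> in the theorem.\<close>

lemma r_Lah_Suc_Suc:
  "r_Lah r (Suc n) (Suc k) = r_Lah r n k + (n + Suc k + 2 * r) * r_Lah r n (Suc k)"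
proof -
  have "{..<Suc n + r} = insert (n + r) {..<n + r}" by auto
  then show ?thesis
    using card_ordered_partitions_insert_Suc[of "{..<n + r}" "n + r" "{..<r}" "k + r"]
    by (simp add: r_Lah_eq algebra_simps)
qed

lemma r_Lah_eq_0: "n < k \<Longrightarrow> r_Lah r n k = 0"
proof (induction n arbitrary: k)
  case 0
  then show ?case by (simp add: r_Lah_0)
next
  case (Suc n)
  then show ?case by (cases k) (simp_all add: r_Lah_Suc_Suc)
qed

section \<open>Generating function and recurrence of the r-extended Bell numbers\<close>

text \<open>The equation expresses coefficient n + 1 through the coefficients up to n, after
  division by n + 1.\<close>

lemma fps_linear_ODE_unique:
  fixes F G h :: "'a::field_char_0 fps"
  assumes "fps_deriv F = F * h" "fps_deriv G = G * h" "fps_nth F 0 = fps_nth G 0"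
  shows "F = G"
proof -
  have nth: "fps_nth H (Suc n) = (\<Sum>i=0..n. fps_nth H i * fps_nth h (n - i)) / of_nat (Suc n)"
    if "fps_deriv H = H * h" for H :: "'a fps" and n
  proof -
    have "of_nat (Suc n) * fps_nth H (Suc n) = fps_nth (fps_deriv H) n" by simp
    also have "\<dots> = (\<Sum>i=0..n. fps_nth H i * fps_nth h (n - i))"
      unfolding that by (simp add: fps_mult_nth)
    finally show ?thesis by (simp add: field_simps del: of_nat_Suc)
  qed
  have "fps_nth F n = fps_nth G n" for n
  proof (induction n rule: less_induct)
    case (less n)
    then show ?case
      using assms(3) by (cases n) (simp_all add: nth[OF assms(1)] nth[OF assms(2)])
  qed
  then show ?thesis by (simp add: fps_eq_iff)
qed

lemma ext_Bell_egf_nth_0: "fps_nth (ext_Bell_egf r) 0 = 1"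
  by (simp add: ext_Bell_egf_def)

lemma fps_deriv_ext_Bell_egf:
  "fps_deriv (ext_Bell_egf r) = ext_Bell_egf r * (fps_exp 1 + of_nat r)"
  unfolding ext_Bell_egf_def by (subst fps_compose_deriv) simp_all

text \<open>Both sides have constant term 1 and logarithmic derivative e^t + r + 1.\<close>

lemma ext_Bell_egf_Suc: "ext_Bell_egf (Suc r) = ext_Bell_egf r * fps_exp 1"
  by (rule fps_linear_ODE_unique[where h = "fps_exp 1 + of_nat (Suc r)"])
     (simp_all add: fps_deriv_ext_Bell_egf ext_Bell_egf_nth_0 algebra_simps)

lemma ext_Bell_0: "ext_Bell 0 r = 1"
  by (simp add: ext_Bell_def ext_Bell_egf_nth_0)

text \<open>Coefficient form of the differential equation, with the factor e^t absorbed by raising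
  \<open>r\<close> to \<open>Suc r\<close>.\<close>

lemma ext_Bell_Suc: "ext_Bell (Suc n) r = ext_Bell n (Suc r) + real r * ext_Bell n r"
proof -
  have "real (Suc n) * fps_nth (ext_Bell_egf r) (Suc n) = fps_nth (fps_deriv (ext_Bell_egf r)) n"
    by simp
  also have "\<dots> = fps_nth (ext_Bell_egf (Suc r) + of_nat r * ext_Bell_egf r) n"
    unfolding fps_deriv_ext_Bell_egf ext_Bell_egf_Suc by (simp add: algebra_simps)
  finally have "real (Suc n) * fps_nth (ext_Bell_egf r) (Suc n) =
      fps_nth (ext_Bell_egf (Suc r)) n + real r * fps_nth (ext_Bell_egf r) n"
    by (simp add: fps_of_nat [symmetric])
  moreover have "ext_Bell (Suc n) r =
      fact n * (real (Suc n) * fps_nth (ext_Bell_egf r) (Suc n))"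
    by (simp add: ext_Bell_def)
  ultimately show ?thesis
    by (simp add: ext_Bell_def algebra_simps)
qed

section \<open>The linear functional with moments \<open>ext_Bell i s\<close>\<close>

definition Bell_functional :: "nat \<Rightarrow> int poly \<Rightarrow> real" where
  "Bell_functional s p = (\<Sum>i\<le>degree p. real_of_int (coeff p i) * ext_Bell i s)"

text \<open>Padding with zero coefficients gives different polynomials a common summation range, as
  additivity requires.\<close>

lemma Bell_functional_eq:
  assumes "degree p \<le> N"
  shows "Bell_functional s p = (\<Sum>i\<le>N. real_of_int (coeff p i) * ext_Bell i s)"
  unfolding Bell_functional_def
  by (rule sum.mono_neutral_left) (use assms in \<open>auto simp: coeff_eq_0\<close>)

lemma Bell_functional_1: "Bell_functional s 1 = 1"
  by (simp add: Bell_functional_def ext_Bell_0)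

lemma Bell_functional_0: "Bell_functional s 0 = 0"
  by (simp add: Bell_functional_def)

lemma Bell_functional_add: "Bell_functional s (p + q) = Bell_functional s p + Bell_functional s q"
proof -
  let ?N = "max (degree p) (degree q)"
  show ?thesis
    using Bell_functional_eq[of p ?N s] Bell_functional_eq[of q ?N s]
      Bell_functional_eq[of "p + q" ?N s]
    by (simp add: degree_add_le sum.distrib algebra_simps)
qed

lemma Bell_functional_smult: "Bell_functional s (smult c p) = real_of_int c * Bell_functional s p"
  using Bell_functional_eq[of "smult c p" "degree p" s] Bell_functional_eq[of p "degree p" s]
  by (simp add: degree_smult_le sum_distrib_left mult.assoc)

lemma Bell_functional_sum: "Bell_functional s (\<Sum>k\<in>A. f k) = (\<Sum>k\<in>A. Bell_functional s (f k))"
  by (induction A rule: infinite_finite_induct) (simp_all add: Bell_functional_0 Bell_functional_add)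

lemma Bell_functional_monom: "Bell_functional s (monom 1 n) = ext_Bell n s"
  by (simp add: Bell_functional_def degree_monom_eq sum.delta if_distrib[of "\<lambda>x. x * _"]
      if_distrib[of real_of_int] cong: if_cong)

text \<open>Multiplication by x raises each moment index by one, so \<open>ext_Bell_Suc\<close>
  applies to each term.\<close>

lemma Bell_functional_pCons_0:
  "Bell_functional s (pCons 0 p) = Bell_functional (Suc s) p + real s * Bell_functional s p"
proof -
  have "Bell_functional s (pCons 0 p) =
      (\<Sum>i\<le>Suc (degree p). real_of_int (coeff (pCons 0 p) i) * ext_Bell i s)"
    by (rule Bell_functional_eq) (rule degree_pCons_le)
  also have "\<dots> = (\<Sum>i\<le>degree p. real_of_int (coeff p i) * ext_Bell (Suc i) s)"
    by (subst sum.atMost_Suc_shift) simp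
  also have "\<dots> = Bell_functional (Suc s) p + real s * Bell_functional s p"
    by (simp add: Bell_functional_def ext_Bell_Suc sum.distrib sum_distrib_left algebra_simps)
  finally show ?thesis .
qed

lemma Bell_functional_shift:
  "Bell_functional s ([:- int s, 1:] * p) = Bell_functional (Suc s) p"
proof -
  have "[:- int s, 1:] * p = pCons 0 p + smult (- int s) p"
    by (simp add: algebra_simps)
  then show ?thesis
    by (simp only: Bell_functional_add Bell_functional_smult Bell_functional_pCons_0)
qed

text \<open>Each root s, s + 1, ... that is split off raises the index of the functional by one,
  until it is applied to the constant 1.\<close>

lemma Bell_functional_shifted_falling:
  "Bell_functional s (\<Prod>i<k. [:- int (s + i), 1:]) = 1"
proof (induction k arbitrary: s)
  case 0
  show ?case by (simp add: Bell_functional_1)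
next
  case (Suc k)
  have "(\<Prod>i<Suc k. [:- int (s + i), 1:]) = [:- int s, 1:] * (\<Prod>i<k. [:- int (Suc s + i), 1:])"
    by (subst prod.lessThan_Suc_shift) simp
  then show ?case using Suc[of "Suc s"] by (simp only: Bell_functional_shift)
qed

section \<open>Rising factorials in terms of shifted falling factorials\<close>

definition rising_poly :: "nat \<Rightarrow> int poly" where
  "rising_poly n = (\<Prod>i<n. [:int i, 1:])"

lemma rising_poly_eq_sum_r_Lah:
  "rising_poly n = (\<Sum>k\<le>n. smult (int (r_Lah r n k)) (\<Prod>i<k. [:- int (2 * r + i), 1:]))"
proof (induction n)
  case 0
  show ?case by (simp add: rising_poly_def r_Lah_0)
next
  case (Suc n)
  define F where "F k = (\<Prod>i<k. [:- int (2 * r + i), 1:])" for k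
  define L where "L n k = int (r_Lah r n k)" for n k
  \<comment> \<open>Write x + n = (x - 2r - k) + (n + k + 2r): the first part extends
    \<open>F k\<close> to \<open>F (Suc k)\<close>, the second is the factor in the r-Lah
    recurrence.\<close>
  have step: "F k * [:int n, 1:] = F (Suc k) + smult (int (n + k + 2 * r)) (F k)" for k
    by (simp add: F_def algebra_simps smult_add_left [symmetric] smult_diff_left [symmetric])
  have "rising_poly (Suc n) = rising_poly n * [:int n, 1:]"
    by (simp add: rising_poly_def)
  also have "\<dots> = (\<Sum>k\<le>n. smult (L n k) (F k * [:int n, 1:]))"
    unfolding Suc.IH F_def L_def by (simp only: sum_distrib_right mult_smult_left)
  also have "\<dots> = (\<Sum>k\<le>n. smult (L n k) (F (Suc k))) +
      (\<Sum>k\<le>n. smult (int (n + k + 2 * r) * L n k) (F k))"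
    unfolding step by (simp add: smult_add_right sum.distrib mult.commute)
  \<comment> \<open>The added term \<open>k = Suc n\<close> is zero by \<open>r_Lah_eq_0\<close>; it
    makes room for the index shift that follows.\<close>
  also have "(\<Sum>k\<le>n. smult (int (n + k + 2 * r) * L n k) (F k)) =
      (\<Sum>k\<le>Suc n. smult (int (n + k + 2 * r) * L n k) (F k))"
    by (simp add: L_def r_Lah_eq_0)
  also have "\<dots> = smult (int (n + 2 * r) * L n 0) (F 0) +
      (\<Sum>k\<le>n. smult (int (n + Suc k + 2 * r) * L n (Suc k)) (F (Suc k)))"
    by (subst sum.atMost_Suc_shift) simp
  also have "(\<Sum>k\<le>n. smult (L n k) (F (Suc k))) + \<dots> = smult (L (Suc n) 0) (F 0) +
      (\<Sum>k\<le>n. smult (L (Suc n) (Suc k)) (F (Suc k)))"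
    unfolding L_def r_Lah_Suc_0 r_Lah_Suc_Suc
    by (simp only: of_nat_add of_nat_mult smult_add_left sum.distrib ac_simps)
  also have "\<dots> = (\<Sum>k\<le>Suc n. smult (L (Suc n) k) (F k))"
    by (subst sum.atMost_Suc_shift) simp
  finally show ?case by (simp only: F_def L_def)
qed

lemma Bell_functional_rising_poly:
  "Bell_functional (2 * r) (rising_poly n) = real (ext_Lah_Bell n r)"
  unfolding rising_poly_eq_sum_r_Lah[of n r]
  by (simp only: Bell_functional_sum Bell_functional_smult Bell_functional_shifted_falling)
     (simp add: ext_Lah_Bell_def)

section \<open>Change of basis between monomials and rising factorials\<close>

text \<open>Substituting -x for x turns each factor x - i into -(x + i).\<close>

lemma falling_poly_reflect: "pcompose (falling_poly n) [:0, -1:] = smult ((-1) ^ n) (rising_poly n)"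
proof -
  have "pcompose (falling_poly n) [:0, -1:] = (\<Prod>i<n. smult (-1) [:int i, 1:])"
    by (simp add: falling_poly_def pcompose_prod pcompose_pCons)
  also have "\<dots> = smult ((-1) ^ n) (rising_poly n)"
    unfolding rising_poly_def prod_smult by simp
  finally show ?thesis .
qed

lemma degree_rising_poly: "degree (rising_poly n) = n"
  unfolding rising_poly_def by (subst degree_prod_eq_sum_degree) auto

lemma coeff_rising_poly:
  assumes "k \<le> n"
  shows "coeff (rising_poly n) k = (-1) ^ (n - k) * S1 n k"
proof -
  have "(-1) ^ n * coeff (rising_poly n) k = (-1) ^ k * S1 n k"
    using coeff_pcompose_linear[of "falling_poly n" "-1" k]
    by (simp add: falling_poly_reflect S1_def)
  then have "(-1) ^ n * ((-1) ^ n * coeff (rising_poly n) k) = (-1) ^ n * ((-1) ^ k * S1 n k)"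
    by simp
  \<comment> \<open>The exponents n + k and n - k have the same parity; \<open>k \<le> n\<close>
    keeps the subtraction from being truncated.\<close>
  moreover have "(-1) ^ n * (-1) ^ k = ((-1) ^ (n - k) :: int)"
    using assms by (simp add: minus_one_power_iff)
  ultimately show ?thesis
    by (simp add: mult.assoc [symmetric] power_mult_distrib [symmetric])
qed

lemma smult_sum_right: "smult c (\<Sum>i\<in>A. f i) = (\<Sum>i\<in>A. smult c (f i))"
  by (induction A rule: infinite_finite_induct) (simp_all add: smult_add_right)

text \<open>The expansion \<open>monom_eq_sum_Stirling\<close> in falling factorials, reflected by x
  to -x.\<close>

lemma monom_eq_sum_rising_poly:
  "monom 1 n = (\<Sum>k\<le>n. smult ((-1) ^ (n - k) * int (Stirling n k)) (rising_poly k))"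
proof -
  have refl: "pcompose (monom 1 n) [:0, -1:] = smult ((-1) ^ n) (monom (1 :: int) n)"
    by (rule poly_eqI) (simp add: coeff_pcompose_linear)
  have "monom 1 n = smult ((-1) ^ n) (pcompose (monom (1 :: int) n) [:0, -1:])"
    unfolding refl by (simp add: power_mult_distrib [symmetric])
  also have "\<dots> = (\<Sum>k\<le>n. smult ((-1) ^ n * (int (Stirling n k) * (-1) ^ k)) (rising_poly k))"
    by (subst monom_eq_sum_Stirling)
       (simp add: pcompose_sum pcompose_smult falling_poly_reflect smult_sum_right)
  also have "\<dots> = (\<Sum>k\<le>n. smult ((-1) ^ (n - k) * int (Stirling n k)) (rising_poly k))"
    by (intro sum.cong refl arg_cong2[where f = smult]) (auto simp: minus_one_power_iff)
  finally show ?thesis .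
qed

theorem theorem6:
  fixes n r :: nat
  shows "real (ext_Lah_Bell n r) =
           (\<Sum>k\<le>n. (-1) ^ (n - k) * real_of_int (S1 n k) * ext_Bell k (2 * r)) \<and>
         ext_Bell n (2 * r) =
           (\<Sum>k\<le>n. (-1) ^ (n - k) * real (Stirling n k) * real (ext_Lah_Bell k r))"
proof
  have "real (ext_Lah_Bell n r) = Bell_functional (2 * r) (rising_poly n)"
    by (simp only: Bell_functional_rising_poly)
  also have "\<dots> = (\<Sum>k\<le>n. (-1) ^ (n - k) * real_of_int (S1 n k) * ext_Bell k (2 * r))"
    unfolding Bell_functional_def degree_rising_poly
    by (intro sum.cong refl) (simp add: coeff_rising_poly)
  finally show "real (ext_Lah_Bell n r) =
      (\<Sum>k\<le>n. (-1) ^ (n - k) * real_of_int (S1 n k) * ext_Bell k (2 * r))" .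
  have "ext_Bell n (2 * r) = Bell_functional (2 * r) (monom 1 n)"
    by (simp only: Bell_functional_monom)
  also have "\<dots> = (\<Sum>k\<le>n. (-1) ^ (n - k) * real (Stirling n k) * real (ext_Lah_Bell k r))"
    by (subst monom_eq_sum_rising_poly)
       (simp add: Bell_functional_sum Bell_functional_smult Bell_functional_rising_poly)
  finally show "ext_Bell n (2 * r) =
      (\<Sum>k\<le>n. (-1) ^ (n - k) * real (Stirling n k) * real (ext_Lah_Bell k r))" .
qed

end
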